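(* Let $p$ be an odd prime and let $\lambda\in\mathbb{C}_p$ with $|\lambda|_p\ge1$. Then for every integer $n\ge1$, \[ -(n-1)!\,(-\lambda)^{n-1}=\beta_{n,\lambda}-(-1)^n\beta_{n,-\lambda}. \] Moreover, for every $a\in\frac{1}{\lambda}E$ with $a\neq0$, \[ \frac{a}{2}\coth_\lambda\Big(\frac12:a\Big)=\sum_{n=0}^\infty\left(\sum_{m=0}^n\binom{n}{m}\frac{\beta_{m,\lambda}+(-1)^m\beta_{m,-\lambda}}{2}\,C_{n-m}\,\lambda^{n-m}\right)\frac{a^n}{n!}. \]
   Context: $\mathbb{C}_p$ is the completion of an algebraic closure of $\mathbb{Q}_p$, with $|p|_p=1/p$; $\mathbb{Z}_p$ is the ring of $p$-adic integers. Let $E=\{x\in\mathbb{C}_p: |x|_p<p^{-1/(p-1)}\}$ and $\frac{1}{\lambda}E=\{t\in\mathbb{C}_p:\lambda t\in E\}$. Let $\log$ and $\exp$ denote the $p$-adic logarithm and exponential. The generalized falling factorials are $(x)_{0,\lambda}=1$, $(x)_{n,\lambda}=x(x-\lambda)\cdots(x-(n-1)\lambda)$ for $n\ge1$. For $a\in\frac1\lambda E$ and $|x|_p\le|\lambda|_p$, the degenerate exponential is $e^x_\lambda(a)=(1+\lambda a)^{x/\lambda}=\exp\big(\tfrac{x}{\lambda}\log(1+\lambda a)\big)=\sum_{n\ge0}(x)_{n,\lambda}\frac{a^n}{n!}$. The degenerate hyperbolic functions are $\cosh_\lambda(x:a)=\frac12\big(e^x_\lambda(a)+e^{-x}_\lambda(a)\big)$,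 $\sinh_\lambda(x:a)=\frac12\big(e^x_\lambda(a)-e^{-x}_\lambda(a)\big)$, and $\coth_\lambda(x:a)=\cosh_\lambda(x:a)/\sinh_\lambda(x:a)$ (for $x\ne0$, $a\ne0$). The Volkenborn integral of a uniformly differentiable $f:\mathbb{Z}_p\to\mathbb{C}_p$ is $\int_{\mathbb{Z}_p}f(x)\,d\mu(x)=\lim_{N\to\infty}p^{-N}\sum_{x=0}^{p^N-1}f(x)$. The degenerate Bernoulli numbers are $\beta_{n,\lambda}=\int_{\mathbb{Z}_p}(x)_{n,\lambda}\,d\mu(x)$ (equivalently $\frac{\frac1\lambda\log(1+\lambda t)}{e_\lambda(t)-1}=\sum_{n\ge0}\beta_{n,\lambda}\frac{t^n}{n!}$ with $e_\lambda(t)=e^1_\lambda(t)$). The Cauchy numbers of the first kind $C_n$ are defined by $\frac{t}{\log(1+t)}=\sum_{n\ge0}C_n\frac{t^n}{n!}$. *)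

theory Defs
  imports
    "HOL-Analysis.Analysis"
    "HOL-Computational_Algebra.Computational_Algebra"
begin

text \<open>The absolute value of a field carrying a translation-invariant metric.\<close>

definition padic_abs :: "'a::{field_char_0, metric_space} \<Rightarrow> real" where
  "padic_abs x = dist x 0"

text \<open>
  The field of \<open>p\<close>-adic numbers inside a complete extension of the \<open>p\<close>-adically valued rationals is
  the topological closure of the rationals.
\<close>

definition Qp :: "'a::{field_char_0, metric_space} set" where
  "Qp = closure \<rat>"

definition Qp_bar :: "'a::{field_char_0, metric_space} set" where
  "Qp_bar = {x. \<exists>q. q \<noteq> 0 \<and> (\<forall>i. poly.coeff q i \<in> Qp) \<and> poly q x = 0}"

text \<open>
  The type \<open>'a\<close> is a copy of \<open>\<complex>\<^sub>p\<close>, the completion of an algebraic closure of the field of \<open>p\<close>-adic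
  numbers: it is a complete field (completeness is part of the sort) whose metric comes from a
  non-archimedean absolute value normalised by \<open>|p| = 1/p\<close>, and the elements algebraic over
  the closure of the rationals form an algebraically closed and dense subset.
  These conditions determine \<open>'a\<close> up to isometric isomorphism.
\<close>

definition padic_complex :: "nat \<Rightarrow> 'a::{field_char_0, complete_space} itself \<Rightarrow> bool" where
  "padic_complex p (T :: 'a itself) \<longleftrightarrow>
     prime p \<and>
     (\<forall>x y :: 'a. dist x y = padic_abs (x - y)) \<and>
     (\<forall>x y :: 'a. padic_abs (x * y) = padic_abs x * padic_abs y) \<and>
     (\<forall>x y :: 'a. padic_abs (x + y) \<le> max (padic_abs x) (padic_abs y)) \<and>
     padic_abs (of_nat p :: 'a) = 1 / real p \<and>
     (\<forall>q :: 'a poly. (\<forall>i. poly.coeff q i \<in> Qp_bar) \<and> degree q > 0 \<longrightarrow>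
        (\<exists>x\<in>Qp_bar. poly q x = 0)) \<and>
     closure (Qp_bar :: 'a set) = UNIV"

definition E_disc :: "nat \<Rightarrow> 'a::{field_char_0, metric_space} set" where
  "E_disc p = {x. padic_abs x < real p powr (- 1 / (real p - 1))}"

definition scaled_E_disc :: "nat \<Rightarrow> 'a::{field_char_0, metric_space} \<Rightarrow> 'a set" where
  "scaled_E_disc p lam = {t. lam * t \<in> E_disc p}"

definition padic_log :: "'a::{field_char_0, metric_space} \<Rightarrow> 'a" where
  "padic_log z = (\<Sum>n. (- 1) ^ n * (z - 1) ^ Suc n / of_nat (Suc n))"

definition padic_exp :: "'a::{field_char_0, metric_space} \<Rightarrow> 'a" where
  "padic_exp x = (\<Sum>n. x ^ n / fact n)"

definition deg_falling :: "'a::field_char_0 \<Rightarrow> 'a \<Rightarrow> nat \<Rightarrow> 'a" where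
  "deg_falling lam x n = (\<Prod>i<n. x - of_nat i * lam)"

definition deg_exp :: "'a::{field_char_0, metric_space} \<Rightarrow> 'a \<Rightarrow> 'a \<Rightarrow> 'a" where
  "deg_exp lam x a = padic_exp (x / lam * padic_log (1 + lam * a))"

definition deg_cosh :: "'a::{field_char_0, metric_space} \<Rightarrow> 'a \<Rightarrow> 'a \<Rightarrow> 'a" where
  "deg_cosh lam x a = (deg_exp lam x a + deg_exp lam (- x) a) / 2"

definition deg_sinh :: "'a::{field_char_0, metric_space} \<Rightarrow> 'a \<Rightarrow> 'a \<Rightarrow> 'a" where
  "deg_sinh lam x a = (deg_exp lam x a - deg_exp lam (- x) a) / 2"

definition deg_coth :: "'a::{field_char_0, metric_space} \<Rightarrow> 'a \<Rightarrow> 'a \<Rightarrow> 'a" where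
  "deg_coth lam x a = deg_cosh lam x a / deg_sinh lam x a"

text \<open>
  The Volkenborn integral over the \<open>p\<close>-adic integers. Only the values of \<open>f\<close> at natural numbers
  enter; the limit exists whenever \<open>f\<close> is uniformly differentiable on the closure of the integers,
  in particular for polynomial functions.
\<close>

definition volkenborn :: "nat \<Rightarrow> ('a::{field_char_0, metric_space} \<Rightarrow> 'a) \<Rightarrow> 'a" where
  "volkenborn p f = lim (\<lambda>N. (\<Sum>x = 0..<p ^ N. f (of_nat x)) / of_nat p ^ N)"

definition deg_bernoulli :: "nat \<Rightarrow> nat \<Rightarrow> 'a::{field_char_0, metric_space} \<Rightarrow> 'a" where
  "deg_bernoulli p n lam = volkenborn p (\<lambda>x. deg_falling lam x n)"

text \<open>
  The Cauchy numbers of the first kind, with exponential generating function \<open>t / log (1 + t)\<close>;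
  \<open>fps_ln 1\<close> is the formal power series of \<open>log (1 + t)\<close>.
\<close>

definition cauchy_number :: "nat \<Rightarrow> 'a::field_char_0" where
  "cauchy_number n = fact n * fps_nth (fps_X / fps_ln 1) n"

end

theory Submission
  imports Defs
begin

text \<open>
  Put \<open>t = \<lambda> a\<close> and \<open>\<mu> = 1 / \<lambda>\<close>. Summing the geometric progression of the formal series
  \<open>(1 + t)^(x \<mu>)\<close> over \<open>x < p^N\<close> and letting \<open>p^N\<close> tend to \<open>0\<close>, which differentiates
  \<open>(1 + t)^(x \<mu>)\<close> at \<open>x = 0\<close>, shows that the numbers \<open>\<beta>\<^sub>n\<^sub>,\<^sub>\<lambda> / (\<lambda>^n n!)\<close> are the coefficients of
  \<open>G \<mu> = \<mu> log (1 + t) / ((1 + t)^\<mu> - 1)\<close>. Formally \<open>G \<mu> - G (- \<mu>) = - \<mu> log (1 + t)\<close>, which is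
  the first identity, while \<open>G \<mu> + G (- \<mu>)\<close> multiplied by the generating function \<open>t / log (1 + t)\<close>
  of the Cauchy numbers is the formal hyperbolic cotangent.

  To evaluate the second identity at \<open>|t| < r = p^(- 1 / (p - 1))\<close>, consider the power series whose
  coefficients satisfy \<open>|c\<^sub>n| r^n \<le> M\<close> for some \<open>M\<close>. They form a ring in which a series is
  invertible if its constant term dominates, and evaluation at \<open>t\<close> is a ring homomorphism
  compatible with composition. By \<open>|n!| \<ge> r^(n - 1)\<close> the series \<open>log (1 + t)\<close> and \<open>(1 + t)^y\<close> for
  \<open>|y| \<le> 1\<close> belong to this ring, and as \<open>|2| = 1\<close>, \<open>((1 + t)^y - (1 + t)^(- y)) / t\<close> is
  invertible in it.
\<close>

section \<open>Ultrametric fields\<close>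

locale ultrametric_field =
  fixes T :: "'a::{field_char_0, complete_space} itself"
  assumes dist_conv_padic_abs: "dist x y = padic_abs (x - y :: 'a)"
    and padic_abs_mult: "padic_abs (x * y :: 'a) = padic_abs x * padic_abs y"
    and padic_abs_add_le: "padic_abs (x + y :: 'a) \<le> max (padic_abs x) (padic_abs y)"
begin

lemma padic_abs_nonneg [simp]: "padic_abs (x :: 'a) \<ge> 0"
  by (simp add: padic_abs_def)

lemma padic_abs_0 [simp]: "padic_abs (0 :: 'a) = 0"
  by (simp add: padic_abs_def)

lemma padic_abs_eq_0_iff [simp]: "padic_abs (x :: 'a) = 0 \<longleftrightarrow> x = 0"
  by (simp add: padic_abs_def)

lemma padic_abs_pos_iff [simp]: "padic_abs (x :: 'a) > 0 \<longleftrightarrow> x \<noteq> 0"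
  by (simp add: padic_abs_def)

lemma padic_abs_1 [simp]: "padic_abs (1 :: 'a) = 1"
  using padic_abs_mult[of 1 1] padic_abs_eq_0_iff[of 1] by simp

lemma padic_abs_minus [simp]: "padic_abs (- x :: 'a) = padic_abs x"
proof -
  have "padic_abs (- 1 :: 'a) ^ 2 = 1"
    using padic_abs_mult[of "- 1" "- 1"] by (simp add: power2_eq_square)
  then have "padic_abs (- 1 :: 'a) = 1"
    by (simp add: power2_eq_1_iff) (smt (verit) padic_abs_nonneg)
  then show ?thesis
    using padic_abs_mult[of "- 1" x] by simp
qed

lemma padic_abs_diff_le: "padic_abs (x - y :: 'a) \<le> max (padic_abs x) (padic_abs y)"
  using padic_abs_add_le[of x "- y"] by simp

lemma padic_abs_triangle_ineq: "padic_abs (x + y :: 'a) \<le> padic_abs x + padic_abs y"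
  using padic_abs_add_le[of x y] padic_abs_nonneg[of x] padic_abs_nonneg[of y] by linarith

lemma padic_abs_power: "padic_abs (x ^ n :: 'a) = padic_abs x ^ n"
  by (induction n) (simp_all add: padic_abs_mult)

lemma padic_abs_inverse: "padic_abs (inverse x :: 'a) = inverse (padic_abs x)"
proof (cases "x = 0")
  case False
  then have "padic_abs (inverse x) * padic_abs x = 1"
    by (simp flip: padic_abs_mult)
  then show ?thesis
    using False by (simp add: field_simps)
qed simp

lemma padic_abs_divide: "padic_abs (x / y :: 'a) = padic_abs x / padic_abs y"
  by (simp add: divide_inverse padic_abs_mult padic_abs_inverse)

lemma padic_abs_prod: "padic_abs (prod f A :: 'a) = (\<Prod>i\<in>A. padic_abs (f i))"
  by (induction A rule: infinite_finite_induct) (simp_all add: padic_abs_mult)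

lemma padic_abs_sum_le:
  assumes "\<And>i. i \<in> A \<Longrightarrow> padic_abs (f i :: 'a) \<le> M" and "M \<ge> 0"
  shows "padic_abs (sum f A) \<le> M"
  using assms(1)
proof (induction A rule: infinite_finite_induct)
  case (insert x A)
  then show ?case
    using padic_abs_add_le[of "f x" "sum f A"] by force
qed (use assms(2) in simp_all)

lemma padic_abs_of_nat_le_1: "padic_abs (of_nat n :: 'a) \<le> 1"
proof (induction n)
  case (Suc n)
  then show ?case
    using padic_abs_add_le[of 1 "of_nat n"] by simp
qed simp

lemma tendsto_iff_padic_abs:
  "(f \<longlongrightarrow> (l :: 'a)) F \<longleftrightarrow> ((\<lambda>x. padic_abs (f x - l)) \<longlongrightarrow> 0) F"
  by (subst tendsto_dist_iff) (simp add: dist_conv_padic_abs)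

lemma tendsto_if_padic_abs_le:
  assumes "\<And>x. padic_abs (f x - l :: 'a) \<le> g x" and "(g \<longlongrightarrow> 0) F"
  shows "(f \<longlongrightarrow> l) F"
  unfolding tendsto_iff_padic_abs
  by (rule tendsto_sandwich[OF _ _ tendsto_const assms(2)]) (simp_all add: assms(1))

lemma padic_tendsto_add:
  assumes "(f \<longlongrightarrow> (a :: 'a)) F" "(g \<longlongrightarrow> b) F"
  shows "((\<lambda>x. f x + g x) \<longlongrightarrow> a + b) F"
proof (rule tendsto_if_padic_abs_le)
  show "padic_abs (f x + g x - (a + b)) \<le> padic_abs (f x - a) + padic_abs (g x - b)" for x
    using padic_abs_triangle_ineq[of "f x - a" "g x - b"] by (simp add: add_diff_add)
  show "((\<lambda>x. padic_abs (f x - a) + padic_abs (g x - b)) \<longlongrightarrow> 0) F"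
    using assms tendsto_add_zero unfolding tendsto_iff_padic_abs by blast
qed

lemma padic_tendsto_mult:
  assumes "(f \<longlongrightarrow> (a :: 'a)) F" "(g \<longlongrightarrow> b) F"
  shows "((\<lambda>x. f x * g x) \<longlongrightarrow> a * b) F"
proof (rule tendsto_if_padic_abs_le)
  fix x
  let ?u = "f x - a" and ?v = "g x - b"
  have "f x * g x - a * b = ?u * ?v + (a * ?v + ?u * b)"
    by (simp add: algebra_simps)
  also have "padic_abs \<dots> \<le> padic_abs (?u * ?v) + (padic_abs (a * ?v) + padic_abs (?u * b))"
    by (meson add_left_mono order.trans padic_abs_triangle_ineq)
  finally show "padic_abs (f x * g x - a * b)
    \<le> padic_abs ?u * padic_abs ?v + (padic_abs a * padic_abs ?v + padic_abs ?u * padic_abs b)"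
    by (simp only: padic_abs_mult)
next
  have "((\<lambda>x. padic_abs (f x - a) * padic_abs (g x - b)
      + (padic_abs a * padic_abs (g x - b) + padic_abs (f x - a) * padic_abs b))
    \<longlongrightarrow> 0 * 0 + (padic_abs a * 0 + 0 * padic_abs b)) F"
    using assms unfolding tendsto_iff_padic_abs by (intro tendsto_intros)
  then show "((\<lambda>x. padic_abs (f x - a) * padic_abs (g x - b)
      + (padic_abs a * padic_abs (g x - b) + padic_abs (f x - a) * padic_abs b)) \<longlongrightarrow> 0) F"
    by simp
qed

lemma padic_tendsto_sum:
  assumes "\<And>i. i \<in> A \<Longrightarrow> (f i \<longlongrightarrow> (a i :: 'a)) F"
  shows "((\<lambda>x. \<Sum>i\<in>A. f i x) \<longlongrightarrow> sum a A) F"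
  using assms by (induction A rule: infinite_finite_induct) (simp_all add: padic_tendsto_add)

lemma padic_tendsto_prod:
  assumes "\<And>i. i \<in> A \<Longrightarrow> (f i \<longlongrightarrow> (a i :: 'a)) F"
  shows "((\<lambda>x. \<Prod>i\<in>A. f i x) \<longlongrightarrow> prod a A) F"
  using assms by (induction A rule: infinite_finite_induct) (simp_all add: padic_tendsto_mult)

lemma padic_tendsto_gbinomial:
  assumes "(f \<longlongrightarrow> (a :: 'a)) F"
  shows "((\<lambda>x. f x gchoose k) \<longlongrightarrow> a gchoose k) F"
proof -
  have "((\<lambda>x. f x - of_nat i) \<longlongrightarrow> a - of_nat i) F" for i
    using padic_tendsto_add[OF assms tendsto_const[of "- of_nat i"]] by simp
  then show ?thesis
    unfolding gbinomial_prod_rev divide_inverse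
    by (intro padic_tendsto_mult padic_tendsto_prod tendsto_const)
qed

lemma padic_sums_add: "f sums (a :: 'a) \<Longrightarrow> g sums b \<Longrightarrow> (\<lambda>n. f n + g n) sums (a + b)"
  unfolding sums_def by (simp add: sum.distrib padic_tendsto_add)

lemma padic_sums_mult: "f sums (a :: 'a) \<Longrightarrow> (\<lambda>n. c * f n) sums (c * a)"
  unfolding sums_def by (simp add: padic_tendsto_mult flip: sum_distrib_left)

lemma padic_sums_Suc:
  assumes "(\<lambda>n. f (Suc n)) sums (a :: 'a)"
  shows "f sums (f 0 + a)"
  unfolding sums_def
proof (rule LIMSEQ_imp_Suc)
  show "(\<lambda>n. \<Sum>i<Suc n. f i) \<longlonglongrightarrow> f 0 + a"
    using assms unfolding sums_def sum.lessThan_Suc_shift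
    by (intro padic_tendsto_add tendsto_const)
qed

end

section \<open>Evaluation of power series over an ultrametric field\<close>

definition fps_value :: "'a::{comm_ring_1, topological_space} fps \<Rightarrow> 'a \<Rightarrow> 'a" where
  "fps_value f t = (\<Sum>n. fps_nth f n * t ^ n)"

definition gauss_bounded :: "real \<Rightarrow> real \<Rightarrow> 'a::{field_char_0, metric_space} fps \<Rightarrow> bool" where
  "gauss_bounded r M f \<longleftrightarrow> (\<forall>n. padic_abs (fps_nth f n) * r ^ n \<le> M)"

lemma gauss_boundedD: "gauss_bounded r M f \<Longrightarrow> padic_abs (fps_nth f n) * r ^ n \<le> M"
  by (simp add: gauss_bounded_def)

lemma gauss_bounded_mono: "gauss_bounded r M f \<Longrightarrow> M \<le> N \<Longrightarrow> gauss_bounded r N f"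
  unfolding gauss_bounded_def using order.trans by blast

context ultrametric_field
begin

lemma gauss_bounded_nonneg: "gauss_bounded r M (f :: 'a fps) \<Longrightarrow> M \<ge> 0"
  using gauss_boundedD[of r M f 0] order.trans[OF padic_abs_nonneg] by simp

lemma gauss_bounded_add:
  assumes "gauss_bounded r M (f :: 'a fps)" "gauss_bounded r M g" "r \<ge> 0"
  shows "gauss_bounded r M (f + g)"
  unfolding gauss_bounded_def
proof
  fix n
  have "padic_abs (fps_nth (f + g) n) * r ^ n
    \<le> max (padic_abs (fps_nth f n)) (padic_abs (fps_nth g n)) * r ^ n"
    using padic_abs_add_le \<open>r \<ge> 0\<close> by (intro mult_right_mono) simp_all
  also have "\<dots> \<le> M"
    using assms(1,2)[THEN gauss_boundedD, of n] by (simp add: max_def)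
  finally show "padic_abs (fps_nth (f + g) n) * r ^ n \<le> M" .
qed

lemma gauss_bounded_minus: "gauss_bounded r M (f :: 'a fps) \<Longrightarrow> gauss_bounded r M (- f)"
  by (simp add: gauss_bounded_def)

lemma gauss_bounded_diff:
  assumes "gauss_bounded r M (f :: 'a fps)" "gauss_bounded r M g" "r \<ge> 0"
  shows "gauss_bounded r M (f - g)"
  using gauss_bounded_add[OF assms(1) gauss_bounded_minus[OF assms(2)] assms(3)] by simp

lemma gauss_bounded_sum:
  assumes "\<And>i. i \<in> A \<Longrightarrow> gauss_bounded r M (f i :: 'a fps)" "r \<ge> 0" "M \<ge> 0"
  shows "gauss_bounded r M (sum f A)"
  using assms
proof (induction A rule: infinite_finite_induct)
  case (insert x A)
  then show ?case
    by (simp add: gauss_bounded_add)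
qed (simp_all add: gauss_bounded_def)

lemma padic_abs_mult_power_le:
  assumes "padic_abs x * r ^ i \<le> M" "padic_abs (y :: 'a) * r ^ j \<le> N" "r \<ge> 0"
  shows "padic_abs (x * y) * r ^ (i + j) \<le> M * N"
proof -
  have "padic_abs (x * y) * r ^ (i + j) = (padic_abs x * r ^ i) * (padic_abs y * r ^ j)"
    by (simp add: padic_abs_mult power_add)
  also have "\<dots> \<le> M * N"
    using assms order.trans[of 0 "padic_abs x * r ^ i" M] by (intro mult_mono) simp_all
  finally show ?thesis .
qed

lemma gauss_bounded_mult:
  assumes "gauss_bounded r M (f :: 'a fps)" "gauss_bounded r N g" "r > 0"
  shows "gauss_bounded r (M * N) (f * g)"
  unfolding gauss_bounded_def
proof
  fix n
  have "padic_abs (\<Sum>i=0..n. fps_nth f i * fps_nth g (n - i)) \<le> M * N / r ^ n"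
  proof (rule padic_abs_sum_le)
    fix i assume "i \<in> {0..n}"
    then show "padic_abs (fps_nth f i * fps_nth g (n - i)) \<le> M * N / r ^ n"
      using padic_abs_mult_power_le[of "fps_nth f i" r i M "fps_nth g (n - i)" "n - i" N]
        assms(1,2)[THEN gauss_boundedD] \<open>r > 0\<close> by (simp add: pos_le_divide_eq)
  qed (use assms gauss_bounded_nonneg in simp)
  then show "padic_abs (fps_nth (f * g) n) * r ^ n \<le> M * N"
    using \<open>r > 0\<close> by (simp add: fps_mult_nth field_simps)
qed

lemma gauss_bounded_const: "padic_abs (c :: 'a) \<le> M \<Longrightarrow> gauss_bounded r M (fps_const c)"
  using order.trans[OF padic_abs_nonneg] by (auto simp: gauss_bounded_def)

lemma gauss_bounded_const_mult:
  assumes "gauss_bounded r M (f :: 'a fps)" "r > 0"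
  shows "gauss_bounded r (padic_abs c * M) (fps_const c * f)"
  using gauss_bounded_mult[OF gauss_bounded_const[OF order.refl] assms] .

lemma gauss_bounded_power:
  assumes "gauss_bounded r M (f :: 'a fps)" "r > 0"
  shows "gauss_bounded r (M ^ k) (f ^ k)"
proof (induction k)
  case 0
  then show ?case
    using gauss_bounded_const[of 1 1] by simp
next
  case (Suc k)
  then show ?case
    using gauss_bounded_mult[OF assms(1) _ assms(2)] by simp
qed

lemma gauss_bounded_X_power_mult:
  assumes "gauss_bounded r M (f :: 'a fps)" "r > 0"
  shows "gauss_bounded r (r ^ k * M) (fps_X ^ k * f)"
proof -
  have "gauss_bounded r r (fps_X :: 'a fps)"
    using assms(2) by (simp add: gauss_bounded_def fps_X_def)
  then show ?thesis
    using assms by (intro gauss_bounded_mult gauss_bounded_power)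
qed

lemma gauss_bounded_shift:
  assumes "gauss_bounded r M (f :: 'a fps)" "r > 0"
  shows "gauss_bounded r (M / r) (fps_shift 1 f)"
  unfolding gauss_bounded_def
proof
  show "padic_abs (fps_nth (fps_shift 1 f) n) * r ^ n \<le> M / r" for n
    using gauss_boundedD[OF assms(1), of "Suc n"] assms(2) by (simp add: field_simps)
qed

lemma gauss_bounded_inverse:
  fixes f :: "'a fps"
  assumes f: "gauss_bounded r (padic_abs (fps_nth f 0)) f" "fps_nth f 0 \<noteq> 0" and "r > 0"
  shows "gauss_bounded r (inverse (padic_abs (fps_nth f 0))) (inverse f)"
  unfolding gauss_bounded_def
proof
  fix n
  show "padic_abs (fps_nth (inverse f) n) * r ^ n \<le> inverse (padic_abs (fps_nth f 0))"
  proof (induction n rule: less_induct)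
    case (less n)
    show ?case
    proof (cases "n = 0")
      case True
      then show ?thesis
        by (simp add: padic_abs_inverse)
    next
      case False
      have "fps_nth (f * inverse f) n = 0"
        using False inverse_mult_eq_1'[OF f(2)] by simp
      then have recursion: "fps_nth f 0 * fps_nth (inverse f) n
          = - (\<Sum>i=1..n. fps_nth f i * fps_nth (inverse f) (n - i))"
        by (simp add: fps_mult_nth sum.atLeast_Suc_atMost eq_neg_iff_add_eq_0)
      have "padic_abs (\<Sum>i=1..n. fps_nth f i * fps_nth (inverse f) (n - i)) \<le> 1 / r ^ n"
      proof (rule padic_abs_sum_le)
        fix i assume i: "i \<in> {1..n}"
        then show "padic_abs (fps_nth f i * fps_nth (inverse f) (n - i)) \<le> 1 / r ^ n"
          using padic_abs_mult_power_le[OF gauss_boundedD[OF f(1), of i] less.IH[of "n - i"]]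
            f(2) \<open>r > 0\<close> by (simp add: pos_le_divide_eq)
      qed (use \<open>r > 0\<close> in simp)
      then have "padic_abs (fps_nth f 0) * padic_abs (fps_nth (inverse f) n) \<le> 1 / r ^ n"
        using recursion by (simp flip: padic_abs_mult)
      then show ?thesis
        using f(2) \<open>r > 0\<close> by (simp add: field_simps)
    qed
  qed
qed

context
  fixes r :: real and t :: 'a
  assumes t_less: "padic_abs t < r"
begin

lemma radius_pos: "r > 0"
  using t_less padic_abs_nonneg[of t] by linarith

lemma gauss_bounded_term_le:
  assumes "gauss_bounded r M f" and "N \<le> n"
  shows "padic_abs (fps_nth f n * t ^ n) \<le> M * (padic_abs t / r) ^ N"
proof -
  have "padic_abs (fps_nth f n * t ^ n) = (padic_abs (fps_nth f n) * r ^ n) * (padic_abs t / r) ^ n"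
    using radius_pos by (simp add: padic_abs_mult padic_abs_power power_divide)
  also have "\<dots> \<le> M * (padic_abs t / r) ^ N"
    using assms gauss_boundedD gauss_bounded_nonneg radius_pos t_less
    by (intro mult_mono power_decreasing) simp_all
  finally show ?thesis .
qed

lemma geometric_bound_tendsto_0: "(\<lambda>N. M * (padic_abs t / r) ^ N) \<longlonglongrightarrow> 0"
  using t_less radius_pos by (intro tendsto_mult_right_zero LIMSEQ_power_zero) simp

lemma gauss_bounded_imp_Cauchy:
  assumes "gauss_bounded r M f"
  shows "Cauchy (\<lambda>n. \<Sum>i<n. fps_nth f i * t ^ i)" (is "Cauchy ?s")
proof -
  have tail: "dist (?s n) (?s N) \<le> M * (padic_abs t / r) ^ N" if "N \<le> n" for N n
  proof -
    have "?s n - ?s N = (\<Sum>i=N..<n. fps_nth f i * t ^ i)"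
      using that sum_diff_nat_ivl[of 0 N n] by (simp add: atLeast0LessThan)
    also have "padic_abs \<dots> \<le> M * (padic_abs t / r) ^ N"
      using that assms gauss_bounded_nonneg radius_pos
      by (intro padic_abs_sum_le gauss_bounded_term_le) auto
    finally show ?thesis
      by (simp add: dist_conv_padic_abs)
  qed
  show ?thesis
    unfolding Cauchy_altdef2
  proof (intro allI impI)
    fix e :: real assume "e > 0"
    then have "\<forall>\<^sub>F N in sequentially. M * (padic_abs t / r) ^ N < e"
      using geometric_bound_tendsto_0 order_tendstoD(2) by blast
    then obtain N where "M * (padic_abs t / r) ^ N < e"
      by (auto simp: eventually_sequentially)
    then show "\<exists>N. \<forall>n\<ge>N. dist (?s n) (?s N) < e"
      using tail order.strict_trans1 by blast
  qed
qed

lemma fps_value_sums: "gauss_bounded r M f \<Longrightarrow> (\<lambda>n. fps_nth f n * t ^ n) sums fps_value f t"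
  unfolding fps_value_def
  by (intro summable_sums)
    (simp add: summable_iff_convergent Cauchy_convergent gauss_bounded_imp_Cauchy)

lemma fps_value_eqI: "(\<lambda>n. fps_nth f n * t ^ n) sums s \<Longrightarrow> fps_value f t = s"
  unfolding fps_value_def by (rule sums_unique[symmetric])

lemma padic_abs_fps_value_le:
  assumes "gauss_bounded r M f" and "\<And>n. n < N \<Longrightarrow> fps_nth f n = 0"
  shows "padic_abs (fps_value f t) \<le> M * (padic_abs t / r) ^ N"
proof -
  have "(\<lambda>n. \<Sum>i<n. fps_nth f i * t ^ i) \<longlonglongrightarrow> fps_value f t"
    using fps_value_sums[OF assms(1)] by (simp add: sums_def)
  then have "(\<lambda>n. padic_abs (\<Sum>i<n. fps_nth f i * t ^ i)) \<longlonglongrightarrow> padic_abs (fps_value f t)"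
    unfolding padic_abs_def by (intro tendsto_dist tendsto_const)
  moreover have "padic_abs (\<Sum>i<n. fps_nth f i * t ^ i) \<le> M * (padic_abs t / r) ^ N" for n
  proof (rule padic_abs_sum_le)
    show "padic_abs (fps_nth f i * t ^ i) \<le> M * (padic_abs t / r) ^ N" for i
      using assms gauss_bounded_term_le[of M f N i] gauss_bounded_nonneg radius_pos
      by (cases "i < N") simp_all
  qed (use assms gauss_bounded_nonneg radius_pos in simp)
  ultimately show ?thesis
    by (intro Lim_bounded) auto
qed

lemma fps_value_add:
  assumes "gauss_bounded r M f" "gauss_bounded r N g"
  shows "fps_value (f + g) t = fps_value f t + fps_value g t"
  using padic_sums_add[OF fps_value_sums[OF assms(1)] fps_value_sums[OF assms(2)]]
  by (intro fps_value_eqI) (simp add: ring_distribs)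

lemma fps_value_const_mult:
  assumes "gauss_bounded r M f"
  shows "fps_value (fps_const c * f) t = c * fps_value f t"
  using padic_sums_mult[OF fps_value_sums[OF assms]]
  by (intro fps_value_eqI) (simp add: mult.assoc)

lemma fps_value_diff:
  assumes "gauss_bounded r M f" "gauss_bounded r N g"
  shows "fps_value (f - g) t = fps_value f t - fps_value g t"
proof -
  have "f - g = f + fps_const (- 1) * g"
    by (simp flip: fps_const_neg)
  also have "fps_value \<dots> t = fps_value f t - fps_value g t"
    using fps_value_add[OF assms(1) gauss_bounded_const_mult[OF assms(2) radius_pos]]
      fps_value_const_mult[OF assms(2)] by simp
  finally show ?thesis .
qed

lemma fps_value_const: "fps_value (fps_const c) t = c"
  using sums_finite[of "{0}" "\<lambda>n. fps_nth (fps_const c) n * t ^ n"]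
  by (intro fps_value_eqI) simp

lemma fps_value_sum:
  assumes "\<And>i. i \<in> A \<Longrightarrow> gauss_bounded r M (f i)" "M \<ge> 0"
  shows "fps_value (sum f A) t = (\<Sum>i\<in>A. fps_value (f i) t)"
  using assms(1)
proof (induction A rule: infinite_finite_induct)
  case (insert x A)
  then show ?case
    using fps_value_add[of M "f x" M "sum f A"] gauss_bounded_sum[of A r M f] radius_pos assms(2)
    by simp
qed (use fps_value_const[of 0] in simp_all)

lemma fps_value_conv_shift:
  assumes "gauss_bounded r M f"
  shows "fps_value f t = fps_nth f 0 + t * fps_value (fps_shift 1 f) t"
proof (rule fps_value_eqI)
  have "(\<lambda>n. t * (fps_nth (fps_shift 1 f) n * t ^ n)) sums (t * fps_value (fps_shift 1 f) t)"
    by (intro padic_sums_mult fps_value_sums[OF gauss_bounded_shift[OF assms radius_pos]])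
  then have "(\<lambda>n. fps_nth f (Suc n) * t ^ Suc n) sums (t * fps_value (fps_shift 1 f) t)"
    by (simp add: mult_ac)
  from padic_sums_Suc[of "\<lambda>n. fps_nth f n * t ^ n", OF this]
  show "(\<lambda>n. fps_nth f n * t ^ n) sums (fps_nth f 0 + t * fps_value (fps_shift 1 f) t)"
    by simp
qed

lemma fps_value_X_power_mult:
  assumes "gauss_bounded r M f"
  shows "fps_value (fps_X ^ k * f) t = t ^ k * fps_value f t"
proof (induction k)
  case (Suc k)
  have "fps_shift 1 (fps_X ^ Suc k * f) = fps_X ^ k * f"
    by (simp add: fps_eq_iff mult.assoc)
  then show ?case
    using fps_value_conv_shift[OF gauss_bounded_X_power_mult[OF assms radius_pos, of "Suc k"]] Suc
    by (simp add: mult_ac)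
qed simp

text \<open>
  Both products and compositions are sums of series divisible by growing powers of the variable,
  so this lemma yields their evaluation.
\<close>

lemma fps_value_formal_sums:
  assumes bounded: "\<And>k. gauss_bounded r M (F k)"
    and low_coeffs: "\<And>k n. n < k \<Longrightarrow> fps_nth (F k) n = 0"
    and nth_formal_sum: "\<And>n. fps_nth H n = (\<Sum>k=0..n. fps_nth (F k) n)"
  shows "gauss_bounded r M H" and "(\<lambda>k. fps_value (F k) t) sums fps_value H t"
proof -
  have "M \<ge> 0"
    using bounded gauss_bounded_nonneg by blast
  then have partial_sum_bounded: "gauss_bounded r M (\<Sum>k<K. F k)" for K
    using bounded radius_pos by (intro gauss_bounded_sum) simp_all
  have nth_partial_sum: "fps_nth H n = fps_nth (\<Sum>k<K. F k) n" if "n < K" for n K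
  proof -
    have "(\<Sum>k<K. fps_nth (F k) n) = (\<Sum>k=0..n. fps_nth (F k) n)"
      using that low_coeffs by (intro sum.mono_neutral_right) auto
    then show ?thesis
      by (simp add: nth_formal_sum fps_sum_nth)
  qed
  show H_bounded: "gauss_bounded r M H"
    unfolding gauss_bounded_def
    using nth_partial_sum[OF lessI] gauss_boundedD[OF partial_sum_bounded] by metis
  show "(\<lambda>k. fps_value (F k) t) sums fps_value H t"
    unfolding sums_def
  proof (rule tendsto_if_padic_abs_le[OF _ geometric_bound_tendsto_0])
    fix K
    have "(\<Sum>k<K. fps_value (F k) t) - fps_value H t = fps_value ((\<Sum>k<K. F k) - H) t"
      using fps_value_diff[OF partial_sum_bounded H_bounded] fps_value_sum[of "{..<K}" M F]
        bounded \<open>M \<ge> 0\<close> by simp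
    also have "padic_abs \<dots> \<le> M * (padic_abs t / r) ^ K"
      using nth_partial_sum partial_sum_bounded H_bounded radius_pos
      by (intro padic_abs_fps_value_le gauss_bounded_diff) simp_all
    finally show "padic_abs ((\<Sum>k<K. fps_value (F k) t) - fps_value H t)
      \<le> M * (padic_abs t / r) ^ K" .
  qed
qed

lemma fps_value_mult:
  assumes f: "gauss_bounded r M f" and g: "gauss_bounded r N g"
  shows "fps_value (f * g) t = fps_value f t * fps_value g t"
proof -
  define F where "F k = fps_const (fps_nth f k) * (fps_X ^ k * g)" for k
  note X_power_g = gauss_bounded_X_power_mult[OF g radius_pos]
  have "gauss_bounded r (M * N) (F k)" for k
  proof (rule gauss_bounded_mono)
    show "gauss_bounded r (padic_abs (fps_nth f k) * (r ^ k * N)) (F k)"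
      unfolding F_def by (intro gauss_bounded_const_mult X_power_g radius_pos)
    show "padic_abs (fps_nth f k) * (r ^ k * N) \<le> M * N"
      using gauss_boundedD[OF f, of k] gauss_bounded_nonneg[OF g]
      by (simp add: mult_right_mono flip: mult.assoc)
  qed
  moreover have "fps_nth (F k) n = 0" if "n < k" for k n
    using that by (simp add: F_def fps_X_power_mult_nth)
  moreover have "fps_nth (f * g) n = (\<Sum>k=0..n. fps_nth (F k) n)" for n
    by (simp add: F_def fps_X_power_mult_nth fps_mult_nth[of f g])
  ultimately have "(\<lambda>k. fps_value (F k) t) sums fps_value (f * g) t"
    by (rule fps_value_formal_sums(2))
  moreover have "fps_value (F k) t = fps_value g t * (fps_nth f k * t ^ k)" for k
    using fps_value_const_mult[OF X_power_g] fps_value_X_power_mult[OF g] by (simp add: F_def)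
  moreover have "(\<lambda>k. fps_value g t * (fps_nth f k * t ^ k)) sums (fps_value g t * fps_value f t)"
    by (intro padic_sums_mult fps_value_sums[OF f])
  ultimately show ?thesis
    using sums_unique2 by (fastforce simp: mult.commute)
qed

lemma fps_value_power:
  assumes "gauss_bounded r M f"
  shows "fps_value (f ^ k) t = fps_value f t ^ k"
proof (induction k)
  case 0
  then show ?case
    using fps_value_const[of 1] by simp
next
  case (Suc k)
  then show ?case
    using fps_value_mult[OF assms gauss_bounded_power[OF assms radius_pos]] by simp
qed

lemma fps_value_compose_sums:
  assumes g: "gauss_bounded r N g" "fps_nth g 0 = 0"
    and f: "\<And>k. padic_abs (fps_nth f k) * N ^ k \<le> M"
  shows "(\<lambda>k. fps_nth f k * fps_value g t ^ k) sums fps_value (f oo g) t"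
proof -
  define F where "F k = fps_const (fps_nth f k) * g ^ k" for k
  note g_power = gauss_bounded_power[OF g(1) radius_pos]
  have "gauss_bounded r M (F k)" for k
    unfolding F_def using gauss_bounded_const_mult[OF g_power radius_pos] f
    by (rule gauss_bounded_mono)
  moreover have "fps_nth (F k) n = 0" if "n < k" for k n
    using that g(2) by (simp add: F_def startsby_zero_power_prefix)
  moreover have "fps_nth (f oo g) n = (\<Sum>k=0..n. fps_nth (F k) n)" for n
    by (simp add: F_def fps_compose_nth)
  ultimately have "(\<lambda>k. fps_value (F k) t) sums fps_value (f oo g) t"
    by (rule fps_value_formal_sums(2))
  moreover have "fps_value (F k) t = fps_nth f k * fps_value g t ^ k" for k
    using fps_value_const_mult[OF g_power] fps_value_power[OF g(1)] by (simp add: F_def)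
  ultimately show ?thesis
    by simp
qed

lemma fps_value_inverse:
  assumes "gauss_bounded r (padic_abs (fps_nth f 0)) f" "fps_nth f 0 \<noteq> 0"
  shows "fps_value (inverse f) t = inverse (fps_value f t)"
proof -
  have "fps_value f t * fps_value (inverse f) t = fps_value (fps_const 1) t"
    using fps_value_mult[OF assms(1) gauss_bounded_inverse[OF assms radius_pos]]
      inverse_mult_eq_1'[OF assms(2)] by simp
  then show ?thesis
    unfolding fps_value_const by (rule inverse_unique[symmetric])
qed

lemma fps_value_divide_sums:
  assumes f: "gauss_bounded r M f"
    and g: "gauss_bounded r (padic_abs (fps_nth g 0)) g" "fps_nth g 0 \<noteq> 0"
  shows "(\<lambda>n. fps_nth (f / g) n * t ^ n) sums (fps_value f t / fps_value g t)"
proof -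
  note g_inverse = gauss_bounded_inverse[OF g radius_pos]
  have "fps_value (f * inverse g) t = fps_value f t / fps_value g t"
    by (simp add: fps_value_mult[OF f g_inverse] fps_value_inverse[OF g] divide_inverse)
  then show ?thesis
    using fps_value_sums[OF gauss_bounded_mult[OF f g_inverse radius_pos]]
    by (simp add: fps_divide_unit[OF g(2)])
qed

end

end

section \<open>Formal generating functions\<close>

lemma fps_dvd_if_nth_1_neq_0:
  fixes f g :: "'a::field fps"
  assumes "fps_nth f 0 = 0" and "fps_nth g 1 \<noteq> 0"
  shows "g dvd f"
proof (cases "f = 0")
  case False
  have "subdegree g \<le> 1"
    using assms(2) by (rule subdegree_leI)
  also have "1 \<le> subdegree f"
    using assms(1) False by (intro subdegree_geI) simp_all
  finally show ?thesis
    using assms(2) False by (subst fps_dvd_iff) auto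
qed simp

lemma fps_X_mult_divide:
  fixes f g :: "'a::field fps"
  assumes "fps_nth g 0 = 0"
  shows "fps_X * f / g = f / fps_shift 1 g"
proof -
  have "g = fps_X * fps_shift 1 g"
    using assms by (simp add: fps_eq_iff)
  then have "fps_X * f / g = fps_X * f / (fps_X * fps_shift 1 g)"
    by (rule arg_cong)
  then show ?thesis
    by simp
qed

lemma fact_power_mult_fps_mult_nth:
  fixes f g :: "'a::field_char_0 fps"
  shows "fact n * c ^ n * fps_nth (f * g) n = (\<Sum>m=0..n. of_nat (n choose m)
    * (fact m * c ^ m * fps_nth f m) * (fact (n - m) * c ^ (n - m) * fps_nth g (n - m)))"
  unfolding fps_mult_nth sum_distrib_left
proof (intro sum.cong refl)
  fix m assume m: "m \<in> {0..n}"
  then have "of_nat (n choose m) * (fact m * fact (n - m)) = (fact n :: 'a)"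
    by (simp add: binomial_fact)
  moreover have "c ^ m * c ^ (n - m) = c ^ n"
    using m by (simp flip: power_add)
  ultimately show "fact n * c ^ n * (fps_nth f m * fps_nth g (n - m)) = of_nat (n choose m)
      * (fact m * c ^ m * fps_nth f m) * (fact (n - m) * c ^ (n - m) * fps_nth g (n - m))"
    by (metis (no_types, opaque_lifting) mult.assoc mult.left_commute)
qed

lemma fps_binomial_conv_compose: "fps_binomial (c :: 'a::field_char_0) = fps_exp c oo fps_ln 1"
proof -
  have "fps_deriv (fps_exp c oo fps_ln 1) = fps_const c * (fps_exp c oo fps_ln 1) / (1 + fps_X)"
    by (simp add: fps_compose_deriv fps_ln_deriv fps_divide_unit mult.assoc
        flip: fps_const_mult_apply_left)
  then show ?thesis
    using fps_binomial_ODE_unique'[of "fps_exp c oo fps_ln 1" c] by simp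
qed

lemma fps_binomial_minus_mult: "fps_binomial c * fps_binomial (- c) = 1"
  using fps_binomial_add_mult[of c "- c"] by simp

lemma fps_binomial_diff_1_neq_0: "\<mu> \<noteq> 0 \<Longrightarrow> fps_binomial \<mu> - 1 \<noteq> (0 :: 'a::field_char_0 fps)"
  by (auto simp: fps_eq_iff intro!: exI[of _ 1])

lemma sum_fps_binomial:
  fixes \<mu> :: "'a::field_char_0"
  assumes "\<mu> \<noteq> 0"
  shows "(\<Sum>x<M. fps_binomial (of_nat x * \<mu>))
    = (fps_binomial (of_nat M * \<mu>) - 1) / (fps_binomial \<mu> - 1)"
proof -
  have "fps_binomial (of_nat M * \<mu>) - 1
      = (fps_binomial \<mu> - 1) * (\<Sum>x<M. fps_binomial (of_nat x * \<mu>))"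
    by (simp flip: fps_binomial_power power_diff_1_eq)
  then show ?thesis
    using fps_binomial_diff_1_neq_0[OF assms] by simp
qed

text \<open>With \<open>\<mu> = 1 / \<lambda>\<close> this is the generating function of \<open>\<beta>\<^sub>n\<^sub>,\<^sub>\<lambda> / (\<lambda>^n n!)\<close>.\<close>

definition bernoulli_gf :: "'a::field_char_0 \<Rightarrow> 'a fps" where
  "bernoulli_gf \<mu> = fps_const \<mu> * fps_ln 1 / (fps_binomial \<mu> - 1)"

lemma bernoulli_gf_mult:
  assumes "\<mu> \<noteq> 0"
  shows "bernoulli_gf \<mu> * (fps_binomial \<mu> - 1) = fps_const \<mu> * fps_ln 1"
  unfolding bernoulli_gf_def
  using assms by (intro dvd_div_mult_self fps_dvd_if_nth_1_neq_0) simp_all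

lemma bernoulli_gf_minus_mult:
  assumes "\<mu> \<noteq> 0"
  shows "bernoulli_gf (- \<mu>) * (fps_binomial \<mu> - 1) = fps_const \<mu> * fps_ln 1 * fps_binomial \<mu>"
proof -
  have "bernoulli_gf (- \<mu>) * (fps_binomial \<mu> - 1)
      = - (bernoulli_gf (- \<mu>) * (fps_binomial (- \<mu>) - 1)) * fps_binomial \<mu>"
    using fps_binomial_minus_mult[of \<mu>] by (simp add: algebra_simps)
  also have "\<dots> = fps_const \<mu> * fps_ln 1 * fps_binomial \<mu>"
    using assms by (simp add: bernoulli_gf_mult flip: fps_const_neg)
  finally show ?thesis .
qed

lemma bernoulli_gf_diff:
  assumes "\<mu> \<noteq> 0"
  shows "bernoulli_gf \<mu> - bernoulli_gf (- \<mu>) = - (fps_const \<mu> * fps_ln 1)"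
proof -
  have "(bernoulli_gf \<mu> - bernoulli_gf (- \<mu>)) * (fps_binomial \<mu> - 1)
      = - (fps_const \<mu> * fps_ln 1) * (fps_binomial \<mu> - 1)"
    unfolding left_diff_distrib bernoulli_gf_mult[OF assms] bernoulli_gf_minus_mult[OF assms]
    by (simp add: algebra_simps)
  then show ?thesis
    using fps_binomial_diff_1_neq_0[OF assms] mult_right_cancel by blast
qed

lemma bernoulli_gf_add_mult:
  assumes "\<mu> \<noteq> 0"
  shows "(bernoulli_gf \<mu> + bernoulli_gf (- \<mu>)) * (fps_binomial \<mu> - 1)
    = fps_const \<mu> * fps_ln 1 * (fps_binomial \<mu> + 1)"
  by (simp add: distrib_right distrib_left bernoulli_gf_mult[OF assms]
      bernoulli_gf_minus_mult[OF assms])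

definition fps_binomial_cosh :: "'a::field_char_0 \<Rightarrow> 'a fps" where
  "fps_binomial_cosh y = fps_const (1 / 2) * (fps_binomial y + fps_binomial (- y))"

definition fps_binomial_sinh :: "'a::field_char_0 \<Rightarrow> 'a fps" where
  "fps_binomial_sinh y = fps_const (1 / 2) * (fps_binomial y - fps_binomial (- y))"

lemma fps_binomial_sinh_neq_0:
  assumes "y \<noteq> 0"
  shows "fps_binomial_sinh y \<noteq> 0"
proof -
  have "fps_nth (fps_binomial_sinh y) 1 = y"
    by (simp add: fps_binomial_sinh_def)
  then show ?thesis
    using assms by auto
qed

lemma
  fixes y :: "'a::field_char_0"
  shows fps_binomial_double_add_1:
      "fps_binomial (2 * y) + 1 = fps_const 2 * fps_binomial y * fps_binomial_cosh y"
    and fps_binomial_double_diff_1: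
      "fps_binomial (2 * y) - 1 = fps_const 2 * fps_binomial y * fps_binomial_sinh y"
proof -
  have halve: "fps_const 2 * f * (fps_const (1 / 2) * g) = f * g" for f g :: "'a fps"
  proof -
    have "fps_const 2 * f * (fps_const (1 / 2) * g) = (fps_const 2 * fps_const (1 / 2)) * (f * g)"
      by (simp only: mult_ac)
    then show ?thesis
      by simp
  qed
  have square: "fps_binomial (2 * y) = fps_binomial y * fps_binomial y"
    using fps_binomial_add_mult[of y y] by simp
  show "fps_binomial (2 * y) + 1 = fps_const 2 * fps_binomial y * fps_binomial_cosh y"
    by (simp only: fps_binomial_cosh_def halve square distrib_left fps_binomial_minus_mult)
  show "fps_binomial (2 * y) - 1 = fps_const 2 * fps_binomial y * fps_binomial_sinh y"
    by (simp only: fps_binomial_sinh_def halve square right_diff_distrib fps_binomial_minus_mult)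
qed

lemma bernoulli_gf_add_mult_sinh:
  fixes y :: "'a::field_char_0"
  assumes "y \<noteq> 0"
  shows "(bernoulli_gf (2 * y) + bernoulli_gf (- (2 * y))) * fps_binomial_sinh y
    = fps_const (2 * y) * fps_ln 1 * fps_binomial_cosh y"
proof -
  have "(bernoulli_gf (2 * y) + bernoulli_gf (- (2 * y)))
      * (fps_const 2 * fps_binomial y * fps_binomial_sinh y)
    = fps_const (2 * y) * fps_ln 1 * (fps_const 2 * fps_binomial y * fps_binomial_cosh y)"
    unfolding fps_binomial_double_add_1[symmetric] fps_binomial_double_diff_1[symmetric]
    using assms by (intro bernoulli_gf_add_mult) simp
  then have "fps_const 2 * fps_binomial y
      * ((bernoulli_gf (2 * y) + bernoulli_gf (- (2 * y))) * fps_binomial_sinh y)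
    = fps_const 2 * fps_binomial y * (fps_const (2 * y) * fps_ln 1 * fps_binomial_cosh y)"
    by (simp only: mult_ac)
  moreover have "fps_const 2 * fps_binomial y \<noteq> 0"
    using fps_binomial_minus_mult[of y] by auto
  ultimately show ?thesis
    using mult_left_cancel by blast
qed

lemma fps_X_div_ln_mult: "fps_X / fps_ln 1 * fps_ln 1 = (fps_X :: 'a::field_char_0 fps)"
  by (intro dvd_div_mult_self fps_dvd_if_nth_1_neq_0) (simp_all add: fps_ln_nth)

definition fps_X_binomial_coth :: "'a::field_char_0 \<Rightarrow> 'a fps" where
  "fps_X_binomial_coth y = fps_X * fps_binomial_cosh y / fps_binomial_sinh y"

lemma fps_X_binomial_coth_mult_sinh:
  assumes "y \<noteq> 0"
  shows "fps_X_binomial_coth y * fps_binomial_sinh y = fps_X * fps_binomial_cosh y"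
  unfolding fps_X_binomial_coth_def using assms
  by (intro dvd_div_mult_self fps_dvd_if_nth_1_neq_0) (simp_all add: fps_binomial_sinh_def)

lemma bernoulli_gf_add_mult_cauchy:
  fixes y :: "'a::field_char_0"
  assumes "y \<noteq> 0"
  shows "fps_const (1 / 2) * (bernoulli_gf (2 * y) + bernoulli_gf (- (2 * y))) * (fps_X / fps_ln 1)
    = fps_const y * fps_X_binomial_coth y" (is "?B = _")
proof -
  have "?B * fps_binomial_sinh y = fps_const (1 / 2) * (fps_X / fps_ln 1)
      * ((bernoulli_gf (2 * y) + bernoulli_gf (- (2 * y))) * fps_binomial_sinh y)"
    by (simp only: mult_ac)
  also have "\<dots> = (fps_const (1 / 2) * fps_const (2 * y)) * (fps_X / fps_ln 1 * fps_ln 1)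
      * fps_binomial_cosh y"
    unfolding bernoulli_gf_add_mult_sinh[OF assms] by (simp only: mult_ac)
  also have "\<dots> = fps_const y * (fps_X * fps_binomial_cosh y)"
    unfolding fps_X_div_ln_mult by (simp add: mult_ac)
  also have "\<dots> = fps_const y * fps_X_binomial_coth y * fps_binomial_sinh y"
    unfolding fps_X_binomial_coth_mult_sinh[OF assms, symmetric] by (simp only: mult_ac)
  finally show ?thesis
    using fps_binomial_sinh_neq_0[OF assms] mult_right_cancel by blast
qed

section \<open>Analysis over a \<open>p\<close>-adic field\<close>

locale padic_field = ultrametric_field T for T :: "'a::{field_char_0, complete_space} itself" +
  fixes p :: nat
  assumes prime_p: "prime p"
    and padic_abs_p: "padic_abs (of_nat p :: 'a) = 1 / real p"
begin

lemma p_gt_1: "p > 1"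
  using prime_p prime_gt_1_nat by blast

lemma padic_abs_of_nat_eq_1:
  assumes "\<not> p dvd m"
  shows "padic_abs (of_nat m :: 'a) = 1"
proof (rule antisym)
  have "coprime m p"
    using assms prime_p prime_imp_coprime_nat coprime_commute by blast
  moreover have "m \<noteq> 0"
    using assms by (intro notI) simp
  ultimately obtain x y where "m * x = p * y + 1"
    using bezout_nat[of m p] by auto
  then have "(1 :: 'a) = of_nat m * of_nat x - of_nat p * of_nat y"
    by (metis add_diff_cancel_left' of_nat_1 of_nat_add of_nat_mult)
  then have "1 \<le> max (padic_abs (of_nat m * of_nat x :: 'a))
      (padic_abs (of_nat p * of_nat y :: 'a))"
    using padic_abs_diff_le padic_abs_1 by metis
  moreover have "padic_abs (of_nat k * of_nat z :: 'a) \<le> padic_abs (of_nat k :: 'a)" for k z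
    using padic_abs_of_nat_le_1[of z] by (simp add: padic_abs_mult mult_left_le)
  ultimately have "1 \<le> max (padic_abs (of_nat m :: 'a)) (1 / real p)"
    using padic_abs_p by (metis max.mono order.trans)
  then show "1 \<le> padic_abs (of_nat m :: 'a)"
    using p_gt_1 by (simp add: le_max_iff_disj)
qed (rule padic_abs_of_nat_le_1)

lemma padic_abs_2_eq_1:
  assumes "odd p"
  shows "padic_abs (2 :: 'a) = 1"
proof -
  have "\<not> p dvd 2"
    using prime_p assms by (metis even_numeral primes_dvd_imp_eq two_is_prime_nat)
  then show ?thesis
    using padic_abs_of_nat_eq_1[of 2] by simp
qed

lemma padic_abs_fact:
  "padic_abs (fact n :: 'a) = (1 / real p) ^ (n div p) * padic_abs (fact (n div p) :: 'a)"
proof (induction n)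
  case (Suc n)
  show ?case
  proof (cases "p dvd Suc n")
    case True
    then have "padic_abs (of_nat (Suc n) :: 'a)
        = 1 / real p * padic_abs (of_nat (Suc n div p) :: 'a)"
      by (metis dvd_mult_div_cancel of_nat_mult padic_abs_mult padic_abs_p)
    moreover have "Suc n div p = Suc (n div p)"
      using True by (simp add: div_Suc dvd_eq_mod_eq_0)
    ultimately show ?thesis
      using Suc by (simp add: padic_abs_mult del: of_nat_Suc)
  next
    case False
    then have "padic_abs (of_nat (Suc n) :: 'a) = 1"
      by (rule padic_abs_of_nat_eq_1)
    moreover have "Suc n div p = n div p"
      using False by (simp add: div_Suc dvd_eq_mod_eq_0)
    ultimately show ?thesis
      using Suc by (simp add: padic_abs_mult del: of_nat_Suc)
  qed
qed simp

definition exp_radius :: real where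
  "exp_radius = real p powr (- 1 / (real p - 1))"

lemma exp_radius_pos: "exp_radius > 0"
  using p_gt_1 by (simp add: exp_radius_def)

lemma exp_radius_le_1: "exp_radius \<le> 1"
  unfolding exp_radius_def using p_gt_1 powr_mono[of "- 1 / (real p - 1)" 0 "real p"] by simp

lemma exp_radius_power: "exp_radius ^ (p - 1) = 1 / real p"
proof -
  have "exp_radius ^ (p - 1) = real p powr (real (p - 1) * (- 1 / (real p - 1)))"
    unfolding exp_radius_def using p_gt_1 by (subst powr_power) simp_all
  also have "real (p - 1) * (- 1 / (real p - 1)) = - 1"
    using p_gt_1 by (simp add: of_nat_diff)
  finally show ?thesis
    using p_gt_1 by (simp add: powr_minus divide_inverse)
qed

lemma padic_abs_fact_ge: "padic_abs (fact n :: 'a) \<ge> exp_radius ^ (n - 1)"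
proof (induction n rule: less_induct)
  case (less n)
  define q where "q = n div p"
  have fact_n: "padic_abs (fact n :: 'a) = (1 / real p) ^ q * padic_abs (fact q :: 'a)"
    unfolding q_def by (rule padic_abs_fact)
  show ?case
  proof (cases "q = 0")
    case True
    then show ?thesis
      using fact_n exp_radius_pos exp_radius_le_1 by (simp add: power_le_one)
  next
    case False
    then have "q < n"
      unfolding q_def using p_gt_1 by (intro div_less_dividend) (auto intro: gr0I)
    have "(p - 1) * q + (q - 1) = p * q - 1"
      using False p_gt_1 by (cases p; cases q) simp_all
    moreover have "p * q \<le> n"
      by (simp add: q_def)
    ultimately have "exp_radius ^ (n - 1) \<le> exp_radius ^ ((p - 1) * q + (q - 1))"
      using exp_radius_pos exp_radius_le_1 by (intro power_decreasing) linarith+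
    also have "\<dots> = (1 / real p) ^ q * exp_radius ^ (q - 1)"
      by (simp only: power_add power_mult exp_radius_power)
    also have "\<dots> \<le> padic_abs (fact n :: 'a)"
      unfolding fact_n using less.IH[OF \<open>q < n\<close>] by (intro mult_left_mono) simp_all
    finally show ?thesis .
  qed
qed

lemma padic_abs_of_nat_ge:
  assumes "n > 0"
  shows "padic_abs (of_nat n :: 'a) \<ge> exp_radius ^ (n - 1)"
proof -
  have "fact n = (of_nat n * of_nat (fact (n - 1)) :: 'a)"
    using assms by (simp add: fact_reduce)
  then have "padic_abs (fact n :: 'a) \<le> padic_abs (of_nat n :: 'a)"
    using padic_abs_of_nat_le_1 by (simp only: padic_abs_mult mult_left_le padic_abs_nonneg)
  then show ?thesis
    using padic_abs_fact_ge[of n] by simp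
qed

lemma gauss_bounded_ln: "gauss_bounded exp_radius exp_radius (fps_ln (1 :: 'a))"
  unfolding gauss_bounded_def
proof
  fix n
  show "padic_abs (fps_nth (fps_ln 1) n :: 'a) * exp_radius ^ n \<le> exp_radius"
  proof (cases n)
    case 0
    then show ?thesis
      using exp_radius_pos by simp
  next
    case (Suc m)
    then show ?thesis
      using padic_abs_of_nat_ge[of n] exp_radius_pos
      by (simp add: fps_ln_nth padic_abs_divide padic_abs_power field_simps del: of_nat_Suc)
  qed
qed

lemma gauss_bounded_exp:
  assumes "padic_abs (y :: 'a) \<le> 1"
  shows "gauss_bounded exp_radius 1 (fps_exp y)"
  unfolding gauss_bounded_def
proof
  fix n
  have "exp_radius ^ n \<le> exp_radius ^ (n - 1)"
    using exp_radius_pos exp_radius_le_1 by (intro power_decreasing) simp_all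
  then have "padic_abs y ^ n * exp_radius ^ n \<le> 1 * padic_abs (fact n :: 'a)"
    using padic_abs_fact_ge[of n] assms exp_radius_pos by (intro mult_mono power_le_one) simp_all
  then show "padic_abs (fps_nth (fps_exp y) n) * exp_radius ^ n \<le> 1"
    by (simp add: padic_abs_divide padic_abs_power divide_le_eq)
qed

lemma padic_abs_gbinomial_Suc_le:
  assumes "padic_abs (y :: 'a) \<le> 1"
  shows "padic_abs (y gchoose Suc n) * exp_radius ^ n \<le> padic_abs y"
proof -
  have factor_le_1: "padic_abs (y - of_nat i) \<le> 1" for i
    using padic_abs_diff_le[of y "of_nat i"] padic_abs_of_nat_le_1[of i] assms by simp
  have "padic_abs (y gchoose Suc n) * exp_radius ^ n
      \<le> padic_abs (y gchoose Suc n) * padic_abs (fact (Suc n) :: 'a)"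
    using padic_abs_fact_ge[of "Suc n"] by (intro mult_left_mono) simp_all
  also have "\<dots> = padic_abs (\<Prod>i = 0..<Suc n. y - of_nat i)"
    by (simp only: gbinomial_mult_fact' flip: padic_abs_mult)
  also have "\<dots> = padic_abs y * (\<Prod>i = 1..<Suc n. padic_abs (y - of_nat i))"
    by (simp add: padic_abs_prod padic_abs_mult prod.atLeast_Suc_lessThan del: prod.op_ivl_Suc)
  also have "\<dots> \<le> padic_abs y"
    using factor_le_1 by (intro mult_left_le prod_le_1) simp_all
  finally show ?thesis .
qed

lemma gauss_bounded_shift_binomial:
  assumes "padic_abs (y :: 'a) \<le> 1"
  shows "gauss_bounded exp_radius (padic_abs y) (fps_shift 1 (fps_binomial y))"
  using padic_abs_gbinomial_Suc_le[OF assms] by (simp add: gauss_bounded_def)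

lemma gauss_bounded_binomial:
  assumes "padic_abs (y :: 'a) \<le> 1"
  shows "gauss_bounded exp_radius 1 (fps_binomial y)"
  unfolding gauss_bounded_def
proof
  fix n
  show "padic_abs (fps_nth (fps_binomial y) n) * exp_radius ^ n \<le> 1"
  proof (cases n)
    case (Suc m)
    have "padic_abs (y gchoose Suc m) * exp_radius ^ Suc m
        \<le> padic_abs (y gchoose Suc m) * exp_radius ^ m"
      using exp_radius_pos exp_radius_le_1 by (intro mult_left_mono power_decreasing) simp_all
    also have "\<dots> \<le> 1"
      using padic_abs_gbinomial_Suc_le[OF assms] assms by (rule order.trans)
    finally show ?thesis
      by (simp add: Suc)
  qed simp
qed

lemma padic_log_conv_fps_value:
  assumes "padic_abs (t :: 'a) < exp_radius"
  shows "padic_log (1 + t) = fps_value (fps_ln 1) t"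
proof -
  note ln_shift = gauss_bounded_shift[OF gauss_bounded_ln exp_radius_pos]
  have "(\<lambda>n. t * (fps_nth (fps_shift 1 (fps_ln 1)) n * t ^ n)) sums
      (t * fps_value (fps_shift 1 (fps_ln 1)) t)"
    by (intro padic_sums_mult fps_value_sums[OF assms ln_shift])
  also have "t * fps_value (fps_shift 1 (fps_ln 1)) t = fps_value (fps_ln 1) t"
    using fps_value_conv_shift[OF assms gauss_bounded_ln] by simp
  also have "(\<lambda>n. t * (fps_nth (fps_shift 1 (fps_ln 1)) n * t ^ n))
      = (\<lambda>n. (- 1) ^ n * (1 + t - 1) ^ Suc n / of_nat (Suc n))"
    by (simp add: fps_ln_nth fun_eq_iff mult_ac del: of_nat_Suc)
  finally show ?thesis
    unfolding padic_log_def by (rule sums_unique[symmetric])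
qed

lemma padic_exp_mult_log:
  assumes "padic_abs (t :: 'a) < exp_radius" and "padic_abs y \<le> 1"
  shows "padic_exp (y * padic_log (1 + t)) = fps_value (fps_binomial y) t"
proof -
  have "(\<lambda>k. fps_nth (fps_exp y) k * fps_value (fps_ln 1) t ^ k)
      sums fps_value (fps_binomial y) t"
    unfolding fps_binomial_conv_compose
    using fps_value_compose_sums[OF assms(1) gauss_bounded_ln fps_ln_0
        gauss_boundedD[OF gauss_bounded_exp[OF assms(2)]]] .
  then show ?thesis
    unfolding padic_exp_def padic_log_conv_fps_value[OF assms(1)]
    by (intro sums_unique[symmetric]) (simp add: power_mult_distrib)
qed

lemma padic_abs_less_exp_radius_iff:
  "padic_abs (lam * a :: 'a) < exp_radius \<longleftrightarrow> a \<in> scaled_E_disc p lam"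
  by (simp add: scaled_E_disc_def E_disc_def exp_radius_def)

lemma deg_exp_conv_fps_value:
  assumes "a \<in> scaled_E_disc p (lam :: 'a)" and "padic_abs x \<le> padic_abs lam"
  shows "deg_exp lam x a = fps_value (fps_binomial (x / lam)) (lam * a)"
proof -
  have "padic_abs (x / lam) \<le> 1"
    using assms(2) by (simp add: padic_abs_divide divide_le_eq_1)
  then show ?thesis
    unfolding deg_exp_def using assms(1) padic_abs_less_exp_radius_iff padic_exp_mult_log by blast
qed

lemma
  assumes "padic_abs (y :: 'a) \<le> 1"
  shows gauss_bounded_binomial_cosh:
      "gauss_bounded exp_radius (padic_abs (1 / 2 :: 'a)) (fps_binomial_cosh y)"
    and gauss_bounded_binomial_sinh:
      "gauss_bounded exp_radius (padic_abs (1 / 2 :: 'a)) (fps_binomial_sinh y)"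
    and fps_value_binomial_cosh: "padic_abs t < exp_radius \<Longrightarrow> fps_value (fps_binomial_cosh y) t
      = (fps_value (fps_binomial y) t + fps_value (fps_binomial (- y)) t) / 2"
    and fps_value_binomial_sinh: "padic_abs t < exp_radius \<Longrightarrow> fps_value (fps_binomial_sinh y) t
      = (fps_value (fps_binomial y) t - fps_value (fps_binomial (- y)) t) / 2"
proof -
  have bounded: "gauss_bounded exp_radius 1 (fps_binomial y)"
    "gauss_bounded exp_radius 1 (fps_binomial (- y))"
    using assms by (simp_all add: gauss_bounded_binomial)
  note add_bounded = gauss_bounded_add[OF bounded less_imp_le[OF exp_radius_pos]]
    and diff_bounded = gauss_bounded_diff[OF bounded less_imp_le[OF exp_radius_pos]]
  show "gauss_bounded exp_radius (padic_abs (1 / 2 :: 'a)) (fps_binomial_cosh y)"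
    using gauss_bounded_const_mult[OF add_bounded exp_radius_pos]
    by (simp add: fps_binomial_cosh_def)
  show "gauss_bounded exp_radius (padic_abs (1 / 2 :: 'a)) (fps_binomial_sinh y)"
    using gauss_bounded_const_mult[OF diff_bounded exp_radius_pos]
    by (simp add: fps_binomial_sinh_def)
  assume t: "padic_abs t < exp_radius"
  show "fps_value (fps_binomial_cosh y) t
      = (fps_value (fps_binomial y) t + fps_value (fps_binomial (- y)) t) / 2"
    unfolding fps_binomial_cosh_def fps_value_const_mult[OF t add_bounded]
      fps_value_add[OF t bounded]
    by simp
  show "fps_value (fps_binomial_sinh y) t
      = (fps_value (fps_binomial y) t - fps_value (fps_binomial (- y)) t) / 2"
    unfolding fps_binomial_sinh_def fps_value_const_mult[OF t diff_bounded]
      fps_value_diff[OF t bounded]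
    by simp
qed

lemma deg_coth_conv_fps_value:
  assumes "a \<in> scaled_E_disc p (lam :: 'a)" and "padic_abs x \<le> padic_abs lam"
  shows "deg_coth lam x a = fps_value (fps_binomial_cosh (x / lam)) (lam * a)
    / fps_value (fps_binomial_sinh (x / lam)) (lam * a)"
proof -
  have "padic_abs (lam * a) < exp_radius" and "padic_abs (x / lam) \<le> 1"
    using assms by (simp_all add: padic_abs_less_exp_radius_iff padic_abs_divide divide_le_eq_1)
  then show ?thesis
    using assms deg_exp_conv_fps_value[of a lam x] deg_exp_conv_fps_value[of a lam "- x"]
    by (simp add: deg_coth_def deg_cosh_def deg_sinh_def fps_value_binomial_cosh
        fps_value_binomial_sinh)
qed

lemma gauss_bounded_shift_binomial_sinh:
  assumes "padic_abs (2 :: 'a) = 1" and "padic_abs (y :: 'a) \<le> 1"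
  shows "gauss_bounded exp_radius (padic_abs y) (fps_shift 1 (fps_binomial_sinh y))"
proof -
  have "gauss_bounded exp_radius (padic_abs y)
      (fps_shift 1 (fps_binomial y) - fps_shift 1 (fps_binomial (- y)))"
    using assms(2) gauss_bounded_shift_binomial[of y] gauss_bounded_shift_binomial[of "- y"]
      exp_radius_pos by (intro gauss_bounded_diff) simp_all
  moreover have "fps_shift 1 (fps_binomial_sinh y)
      = fps_const (1 / 2) * (fps_shift 1 (fps_binomial y) - fps_shift 1 (fps_binomial (- y)))"
    by (simp add: fps_eq_iff fps_binomial_sinh_def)
  ultimately show ?thesis
    using gauss_bounded_const_mult[OF _ exp_radius_pos, of "padic_abs y" _ "1 / 2"] assms(1)
    by (simp add: padic_abs_divide)
qed

lemma fps_X_binomial_coth_sums: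
  assumes abs_2: "padic_abs (2 :: 'a) = 1" and y: "padic_abs (y :: 'a) \<le> 1" "y \<noteq> 0"
    and t: "padic_abs t < exp_radius" "t \<noteq> 0"
  shows "(\<lambda>n. fps_nth (fps_X_binomial_coth y) n * t ^ n)
    sums (t * (fps_value (fps_binomial_cosh y) t / fps_value (fps_binomial_sinh y) t))"
proof -
  let ?S = "fps_shift 1 (fps_binomial_sinh y)"
  have sinh_0: "fps_nth (fps_binomial_sinh y) 0 = 0" and S_0: "fps_nth ?S 0 = y"
    by (simp_all add: fps_binomial_sinh_def)
  have "(\<lambda>n. fps_nth (fps_binomial_cosh y / ?S) n * t ^ n)
      sums (fps_value (fps_binomial_cosh y) t / fps_value ?S t)"
    using gauss_bounded_shift_binomial_sinh[OF abs_2 y(1)] y S_0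
    by (intro fps_value_divide_sums[OF t(1) gauss_bounded_binomial_cosh]) simp_all
  moreover have "fps_value (fps_binomial_sinh y) t = t * fps_value ?S t"
    using fps_value_conv_shift[OF t(1) gauss_bounded_binomial_sinh[OF y(1)]] sinh_0 by simp
  ultimately show ?thesis
    using t(2) by (simp add: fps_X_binomial_coth_def fps_X_mult_divide[OF sinh_0])
qed

end

section \<open>The degenerate Bernoulli numbers and the hyperbolic cotangent\<close>

lemma deg_falling_conv_gbinomial:
  assumes "lam \<noteq> 0"
  shows "deg_falling lam x n = fact n * lam ^ n * ((x / lam) gchoose n)"
proof -
  have "deg_falling lam x n = (\<Prod>i<n. lam * (x / lam - of_nat i))"
    unfolding deg_falling_def using assms by (intro prod.cong) (simp_all add: field_simps)
  then show ?thesis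
    by (simp add: gbinomial_prod_rev prod.distrib atLeast0LessThan)
qed

context ultrametric_field
begin

lemma fps_nth_divide_tendsto:
  assumes "\<And>n. ((\<lambda>x. fps_nth (f x) n) \<longlongrightarrow> (fps_nth g n :: 'a)) F"
  shows "((\<lambda>x. fps_nth (f x / h) n) \<longlongrightarrow> fps_nth (g / h) n) F"
  unfolding fps_divide_def fps_shift_nth fps_mult_nth
  by (intro padic_tendsto_sum padic_tendsto_mult tendsto_const assms)

lemma fps_nth_binomial_difference_quotient_tendsto:
  "((\<lambda>x :: 'a. fps_nth (fps_binomial (x * \<mu>) - 1) n / x)
    \<longlongrightarrow> fps_nth (fps_const \<mu> * fps_ln 1) n) (at 0)"
proof (cases n)
  case (Suc i)
  have "((\<lambda>x :: 'a. \<mu> / of_nat (Suc i) * (x * \<mu> - 1 gchoose i))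
      \<longlongrightarrow> \<mu> / of_nat (Suc i) * (0 * \<mu> + - 1 gchoose i)) (at 0)"
    unfolding diff_conv_add_uminus[of _ "1 :: 'a"]
    by (intro padic_tendsto_mult padic_tendsto_gbinomial padic_tendsto_add tendsto_const
        tendsto_ident_at)
  moreover have "(- 1 gchoose i) = ((- 1) ^ i :: 'a)"
    using gbinomial_minus[of "1 :: 'a" i] binomial_gbinomial[of i i, where ?'a = 'a] by simp
  moreover have "(x * \<mu> gchoose Suc i) / x = \<mu> / of_nat (Suc i) * (x * \<mu> - 1 gchoose i)"
    if "x \<noteq> 0" for x :: 'a
    using that gbinomial_absorption[of i "x * \<mu>"] by (simp add: field_simps del: of_nat_Suc)
  ultimately show ?thesis
    by (subst LIM_cong) (simp_all add: Suc fps_ln_nth del: of_nat_Suc)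
qed simp

end

context padic_field
begin

lemma filterlim_power_p_at_0: "filterlim (\<lambda>N. of_nat p ^ N :: 'a) (at 0) sequentially"
  unfolding filterlim_at using p_gt_1
  by (simp add: tendsto_iff_padic_abs padic_abs_power padic_abs_p LIMSEQ_power_zero)

lemma volkenborn_gbinomial_tendsto:
  assumes "\<mu> \<noteq> (0 :: 'a)"
  shows "(\<lambda>N. (\<Sum>x = 0..<p ^ N. (of_nat x * \<mu> gchoose n)) / of_nat p ^ N)
    \<longlonglongrightarrow> fps_nth (bernoulli_gf \<mu>) n"
proof -
  define Q where "Q x = fps_const (inverse x) * (fps_binomial (x * \<mu>) - 1)" for x :: 'a
  have "(\<lambda>N. fps_nth (Q (of_nat p ^ N)) k) \<longlonglongrightarrow> fps_nth (fps_const \<mu> * fps_ln 1) k" for k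
    using filterlim_compose[OF fps_nth_binomial_difference_quotient_tendsto filterlim_power_p_at_0]
    by (simp add: Q_def divide_inverse mult.commute)
  then have "(\<lambda>N. fps_nth (Q (of_nat p ^ N) / (fps_binomial \<mu> - 1)) n)
      \<longlonglongrightarrow> fps_nth (bernoulli_gf \<mu>) n"
    unfolding bernoulli_gf_def by (rule fps_nth_divide_tendsto)
  moreover have "fps_nth (Q (of_nat p ^ N) / (fps_binomial \<mu> - 1)) n
      = (\<Sum>x = 0..<p ^ N. (of_nat x * \<mu> gchoose n)) / of_nat p ^ N" for N
  proof -
    have "Q (of_nat p ^ N) / (fps_binomial \<mu> - 1)
        = fps_const (inverse (of_nat p ^ N)) * (\<Sum>x<p ^ N. fps_binomial (of_nat x * \<mu>))"
      unfolding sum_fps_binomial[OF assms] Q_def of_nat_power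
      using assms by (intro div_mult_swap[symmetric] fps_dvd_if_nth_1_neq_0) simp_all
    then show ?thesis
      by (simp add: fps_sum_nth atLeast0LessThan divide_inverse mult.commute)
  qed
  ultimately show ?thesis
    by simp
qed

lemma deg_bernoulli_conv_gf:
  assumes "lam \<noteq> (0 :: 'a)"
  shows "deg_bernoulli p n lam = fact n * lam ^ n * fps_nth (bernoulli_gf (1 / lam)) n"
proof -
  have "(\<lambda>N. fact n * lam ^ n * ((\<Sum>x = 0..<p ^ N. (of_nat x * (1 / lam) gchoose n)) / of_nat p ^ N))
    \<longlonglongrightarrow> fact n * lam ^ n * fps_nth (bernoulli_gf (1 / lam)) n"
    using assms by (intro padic_tendsto_mult volkenborn_gbinomial_tendsto tendsto_const) simp
  then show ?thesis
    unfolding deg_bernoulli_def volkenborn_def using assms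
    by (intro limI) (simp add: deg_falling_conv_gbinomial sum_distrib_left)
qed

lemma deg_bernoulli_minus_conv_gf:
  assumes "lam \<noteq> (0 :: 'a)"
  shows "(- 1) ^ n * deg_bernoulli p n (- lam)
    = fact n * lam ^ n * fps_nth (bernoulli_gf (- (1 / lam))) n"
  using assms by (simp add: deg_bernoulli_conv_gf power_minus[of lam])

lemma deg_bernoulli_diff:
  assumes "lam \<noteq> (0 :: 'a)" and "n \<ge> 1"
  shows "deg_bernoulli p n lam - (- 1) ^ n * deg_bernoulli p n (- lam)
    = - fact (n - 1) * (- lam) ^ (n - 1)"
proof -
  obtain m where n: "n = Suc m"
    using assms(2) by (cases n) simp_all
  have "deg_bernoulli p n lam - (- 1) ^ n * deg_bernoulli p n (- lam)
      = fact n * lam ^ n * fps_nth (bernoulli_gf (1 / lam) - bernoulli_gf (- (1 / lam))) n"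
    unfolding deg_bernoulli_conv_gf[OF assms(1)] deg_bernoulli_minus_conv_gf[OF assms(1)]
    by (simp add: algebra_simps)
  also have "\<dots> = - fact m * (- lam) ^ m"
    using assms(1) bernoulli_gf_diff[of "1 / lam"]
    by (simp add: n fps_ln_nth power_minus[of lam] del: of_nat_Suc)
  finally show ?thesis
    by (simp add: n)
qed

lemma deg_bernoulli_cauchy_convolution:
  assumes "lam \<noteq> (0 :: 'a)"
  defines "y \<equiv> 1 / 2 / lam"
  shows "(\<Sum>m = 0..n. of_nat (n choose m)
      * ((deg_bernoulli p m lam + (- 1) ^ m * deg_bernoulli p m (- lam)) / 2)
      * cauchy_number (n - m) * lam ^ (n - m))
    = fact n * lam ^ n * (y * fps_nth (fps_X_binomial_coth y) n)"
proof -
  let ?B = "fps_const (1 / 2) * (bernoulli_gf (1 / lam) + bernoulli_gf (- (1 / lam)))"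
  have even_part: "(deg_bernoulli p m lam + (- 1) ^ m * deg_bernoulli p m (- lam)) / 2
      = fact m * lam ^ m * fps_nth ?B m" for m
    unfolding deg_bernoulli_conv_gf[OF assms(1)] deg_bernoulli_minus_conv_gf[OF assms(1)]
    by (simp add: field_simps)
  have "(\<Sum>m = 0..n. of_nat (n choose m)
      * ((deg_bernoulli p m lam + (- 1) ^ m * deg_bernoulli p m (- lam)) / 2)
      * cauchy_number (n - m) * lam ^ (n - m))
    = fact n * lam ^ n * fps_nth (?B * (fps_X / fps_ln 1)) n"
    unfolding fact_power_mult_fps_mult_nth[of n lam ?B] even_part cauchy_number_def
    by (simp only: mult_ac)
  then show ?thesis
    using assms(1) bernoulli_gf_add_mult_cauchy[of y] by (simp add: y_def)
qed

lemma deg_coth_sums: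
  assumes "odd p" and lam: "padic_abs (lam :: 'a) \<ge> 1" and a: "a \<in> scaled_E_disc p lam" "a \<noteq> 0"
  shows "(\<lambda>n. (\<Sum>m = 0..n. of_nat (n choose m)
      * ((deg_bernoulli p m lam + (- 1) ^ m * deg_bernoulli p m (- lam)) / 2)
      * cauchy_number (n - m) * lam ^ (n - m)) * a ^ n / fact n)
    sums (a / 2 * deg_coth lam (1 / 2) a)"
proof -
  define y where "y = 1 / 2 / lam"
  have "lam \<noteq> 0"
    using lam by auto
  note abs_2 = padic_abs_2_eq_1[OF \<open>odd p\<close>]
  have y: "padic_abs y \<le> 1" "y \<noteq> 0"
    using abs_2 lam \<open>lam \<noteq> 0\<close> by (simp_all add: y_def padic_abs_divide padic_abs_mult)
  have t: "padic_abs (lam * a) < exp_radius" "lam * a \<noteq> 0"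
    using a \<open>lam \<noteq> 0\<close> by (simp_all add: padic_abs_less_exp_radius_iff)
  have "(\<lambda>n. y * (fps_nth (fps_X_binomial_coth y) n * (lam * a) ^ n)) sums (y * (lam * a
      * (fps_value (fps_binomial_cosh y) (lam * a) / fps_value (fps_binomial_sinh y) (lam * a))))"
    by (intro padic_sums_mult fps_X_binomial_coth_sums abs_2 y t)
  also have "fps_value (fps_binomial_cosh y) (lam * a) / fps_value (fps_binomial_sinh y) (lam * a)
      = deg_coth lam (1 / 2) a"
    unfolding y_def using abs_2 lam a
    by (subst deg_coth_conv_fps_value) (simp_all add: padic_abs_divide)
  finally show ?thesis
    unfolding deg_bernoulli_cauchy_convolution[OF \<open>lam \<noteq> 0\<close>, folded y_def]
    using \<open>lam \<noteq> 0\<close> by (simp add: power_mult_distrib y_def mult_ac)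
qed

end

lemma padic_complex_imp_padic_field:
  "padic_complex p TYPE('a::{field_char_0, complete_space}) \<Longrightarrow> padic_field TYPE('a) p"
  unfolding padic_complex_def by unfold_locales blast+

theorem theorem5:
  fixes p :: nat and lam :: "'a::{field_char_0, complete_space}"
  assumes "padic_complex p TYPE('a)"
    and "odd p"
    and "padic_abs lam \<ge> 1"
  shows "(\<forall>n\<ge>1. - fact (n - 1) * (- lam) ^ (n - 1)
            = deg_bernoulli p n lam - (- 1) ^ n * deg_bernoulli p n (- lam))
       \<and> (\<forall>a \<in> scaled_E_disc p lam. a \<noteq> 0 \<longrightarrow>
            (\<lambda>n. (\<Sum>m = 0..n. of_nat (n choose m)
                      * ((deg_bernoulli p m lam + (- 1) ^ m * deg_bernoulli p m (- lam)) / 2)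
                      * cauchy_number (n - m) * lam ^ (n - m))
                  * a ^ n / fact n)
            sums (a / 2 * deg_coth lam (1 / 2) a))"
proof -
  interpret padic_field "TYPE('a)" p
    using assms(1) by (rule padic_complex_imp_padic_field)
  have "lam \<noteq> 0"
    using assms(3) by auto
  then show ?thesis
    using deg_bernoulli_diff[symmetric] deg_coth_sums[OF assms(2,3)] by blast
qed

end
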